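(* Let $G=(V,E)$ be a finite, connected, simple graph with $n=|V|$ vertices, maximum degree $d_M$, and ${\rm Diam}(G)=D$. For any $\kappa_0\in\mathbb{R}$, \[ n\le 1+\sum_{k=1}^{D}(d_M)^k\prod_{i=1}^{k-1}\left[1+\frac{I_{\kappa_0}-i\kappa_0}{2}\right]. \] Moreover, if $\kappa_0>0$, then \[ n\le 1+\sum_{k=1}^{\left\lfloor \frac{2+I_{\kappa_0}}{\kappa_0}\right\rfloor}(d_M)^k\prod_{i=1}^{k-1}\left[1+\frac{I_{\kappa_0}-i\kappa_0}{2}\right]. \]
   Context: $G=(V,E)$ is a finite, connected, simple (unweighted, undirected, no loops or multiple edges) graph; $d(x,y)$ is the graph (shortest-path) distance and ${\rm Diam}(G)=\max_{x,y\in V}d(x,y)$. For $x\in V$, $\Gamma(x)=\{v: vx\in E\}$ and $d_x=|\Gamma(x)|$; $d_M=\max_x d_x$. For probability measures $m_1,m_2$ on $V$, the transportation distance is $W(m_1,m_2)=\inf_A\sum_{x,y\in V}A(x,y)d(x,y)$, the infimum over couplings $A:V\times V\to[0,1]$ with $\sum_y A(x,y)=m_1(x)$ and $\sum_x A(x,y)=m_2(y)$. For $\alpha\in[0,1)$ let $m^\alpha_x(v)=\alpha$ if $v=x$, $(1-\alpha)/d_x$ if $v\in\Gamma(x)$, and $0$ otherwise; $\kappa_\alpha(x,y)=1-W(m^\alpha_x,m^\alpha_y)/d(x,y)$ for $x\ne y$; the Lin–Lu–Yau Ricci curvature is $\kappa_{LLY}(x,y)=\lim_{\alpha\to1^-}\kappa_\alpha(x,y)/(1-\alpha)$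 (this limit exists). For $\kappa_0\in\mathbb{R}$, $\rho_{\kappa_0}(x,y)=\max\{0,\kappa_0-\kappa_{LLY}(x,y)\}$ and $I_{\kappa_0}=\sum_{xy\in E}\rho_{\kappa_0}(x,y)$, summing over edges of $G$ (each counted once). *)

theory Defs
  imports "HOL-Analysis.Analysis"
begin

definition finite_simple_graph :: "'a set \<Rightarrow> 'a set set \<Rightarrow> bool" where
  "finite_simple_graph V E \<longleftrightarrow> finite V \<and> (\<forall>e\<in>E. e \<subseteq> V \<and> card e = 2)"

definition walk :: "'a set \<Rightarrow> 'a set set \<Rightarrow> 'a \<Rightarrow> 'a list \<Rightarrow> 'a \<Rightarrow> bool" where
  "walk V E x xs y \<longleftrightarrow> xs \<noteq> [] \<and> set xs \<subseteq> V \<and> hd xs = x \<and> last xs = y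
     \<and> successively (\<lambda>u v. {u, v} \<in> E) xs"

definition connected_graph :: "'a set \<Rightarrow> 'a set set \<Rightarrow> bool" where
  "connected_graph V E \<longleftrightarrow> V \<noteq> {} \<and> (\<forall>x\<in>V. \<forall>y\<in>V. \<exists>xs. walk V E x xs y)"

text \<open>The length of a walk is its number of edges. A shortest walk is a path, so this is
  the shortest-path distance.\<close>

definition gdist :: "'a set \<Rightarrow> 'a set set \<Rightarrow> 'a \<Rightarrow> 'a \<Rightarrow> nat" where
  "gdist V E x y = (LEAST k. \<exists>xs. walk V E x xs y \<and> length xs = Suc k)"

definition diam :: "'a set \<Rightarrow> 'a set set \<Rightarrow> nat" where
  "diam V E = Max {gdist V E x y | x y. x \<in> V \<and> y \<in> V}"

definition nbhd :: "'a set set \<Rightarrow> 'a \<Rightarrow> 'a set" where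
  "nbhd E x = {v. {v, x} \<in> E}"

definition deg :: "'a set set \<Rightarrow> 'a \<Rightarrow> nat" where
  "deg E x = card (nbhd E x)"

definition max_deg :: "'a set \<Rightarrow> 'a set set \<Rightarrow> nat" where
  "max_deg V E = Max (deg E ` V)"

definition coupling :: "'a set \<Rightarrow> ('a \<Rightarrow> real) \<Rightarrow> ('a \<Rightarrow> real) \<Rightarrow> ('a \<Rightarrow> 'a \<Rightarrow> real) \<Rightarrow> bool" where
  "coupling V m1 m2 A \<longleftrightarrow> (\<forall>x\<in>V. \<forall>y\<in>V. A x y \<in> {0..1})
     \<and> (\<forall>x\<in>V. (\<Sum>y\<in>V. A x y) = m1 x) \<and> (\<forall>y\<in>V. (\<Sum>x\<in>V. A x y) = m2 y)"

definition transport_dist ::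
    "'a set \<Rightarrow> 'a set set \<Rightarrow> ('a \<Rightarrow> real) \<Rightarrow> ('a \<Rightarrow> real) \<Rightarrow> real" where
  "transport_dist V E m1 m2 =
     Inf {(\<Sum>x\<in>V. \<Sum>y\<in>V. A x y * real (gdist V E x y)) | A. coupling V m1 m2 A}"

definition lazy_measure :: "'a set set \<Rightarrow> real \<Rightarrow> 'a \<Rightarrow> 'a \<Rightarrow> real" where
  "lazy_measure E \<alpha> x v =
     (if v = x then \<alpha> else if v \<in> nbhd E x then (1 - \<alpha>) / real (deg E x) else 0)"

definition kappa :: "'a set \<Rightarrow> 'a set set \<Rightarrow> real \<Rightarrow> 'a \<Rightarrow> 'a \<Rightarrow> real" where
  "kappa V E \<alpha> x y =
     1 - transport_dist V E (lazy_measure E \<alpha> x) (lazy_measure E \<alpha> y) / real (gdist V E x y)"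

definition kappa_LLY :: "'a set \<Rightarrow> 'a set set \<Rightarrow> 'a \<Rightarrow> 'a \<Rightarrow> real" where
  "kappa_LLY V E x y = Lim (at_left 1) (\<lambda>\<alpha>. kappa V E \<alpha> x y / (1 - \<alpha>))"

definition rho :: "'a set \<Rightarrow> 'a set set \<Rightarrow> real \<Rightarrow> 'a \<Rightarrow> 'a \<Rightarrow> real" where
  "rho V E \<kappa>\<^sub>0 x y = max 0 (\<kappa>\<^sub>0 - kappa_LLY V E x y)"

text \<open>The value of \<^const>\<open>rho\<close> on an unordered edge; well defined because \<^const>\<open>rho\<close> is
  symmetric, see \<open>rho_edge_doubleton\<close> below.\<close>

definition rho_edge :: "'a set \<Rightarrow> 'a set set \<Rightarrow> real \<Rightarrow> 'a set \<Rightarrow> real" where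
  "rho_edge V E \<kappa>\<^sub>0 e = (THE r. \<exists>x y. e = {x, y} \<and> r = rho V E \<kappa>\<^sub>0 x y)"

definition curv_deficit :: "'a set \<Rightarrow> 'a set set \<Rightarrow> real \<Rightarrow> real" where
  "curv_deficit V E \<kappa>\<^sub>0 = (\<Sum>e\<in>E. rho_edge V E \<kappa>\<^sub>0 e)"

lemma walk_rev: "walk V E x xs y \<Longrightarrow> walk V E y (rev xs) x"
  by (auto simp: walk_def hd_rev last_rev insert_commute)

lemma gdist_sym: "gdist V E x y = gdist V E y x"
proof -
  have "(\<exists>xs. walk V E x xs y \<and> length xs = Suc k) = (\<exists>xs. walk V E y xs x \<and> length xs = Suc k)" for k
    by (metis walk_rev length_rev)
  then show ?thesis by (simp add: gdist_def)
qed

lemma transport_dist_sym: "transport_dist V E m1 m2 = transport_dist V E m2 m1"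
proof -
  have "\<exists>B. (\<Sum>x\<in>V. \<Sum>y\<in>V. A x y * real (gdist V E x y)) =
            (\<Sum>x\<in>V. \<Sum>y\<in>V. B x y * real (gdist V E x y)) \<and> coupling V m2 m1 B"
    if "coupling V m1 m2 A" for A m1 m2
  proof (intro exI[of _ "\<lambda>x y. A y x"] conjI)
    show "(\<Sum>x\<in>V. \<Sum>y\<in>V. A x y * real (gdist V E x y)) =
          (\<Sum>x\<in>V. \<Sum>y\<in>V. A y x * real (gdist V E x y))"
      by (subst sum.swap) (simp add: gdist_sym)
    show "coupling V m2 m1 (\<lambda>x y. A y x)" using that by (auto simp: coupling_def)
  qed
  then have "{(\<Sum>x\<in>V. \<Sum>y\<in>V. A x y * real (gdist V E x y)) | A. coupling V m1 m2 A} =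
             {(\<Sum>x\<in>V. \<Sum>y\<in>V. A x y * real (gdist V E x y)) | A. coupling V m2 m1 A}"
    by blast
  then show ?thesis by (simp add: transport_dist_def)
qed

lemma rho_sym: "rho V E \<kappa>\<^sub>0 x y = rho V E \<kappa>\<^sub>0 y x"
  unfolding rho_def kappa_LLY_def kappa_def
  by (subst transport_dist_sym, subst gdist_sym) (rule refl)

lemma rho_edge_doubleton: "rho_edge V E \<kappa>\<^sub>0 {x, y} = rho V E \<kappa>\<^sub>0 x y"
  unfolding rho_edge_def by (rule the_equality) (auto simp: doubleton_eq_iff rho_sym)

end

theory Submission
  imports Defs
begin

text \<open>Let \<open>x\<close> and \<open>y\<close> be at distance \<open>k\<close>, and let \<open>f\<close> be the distance from \<open>x\<close>. Testing the transport
  problem for each edge of a geodesic from \<open>x\<close> to \<open>y\<close> against the same 1-Lipschitz function \<open>f\<close> makes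
  the lower bounds telescope, and the expectation of \<open>f\<close> at the end point \<open>y\<close> involves the proportion
  \<open>p\<close> of neighbours of \<open>y\<close> farther away from \<open>x\<close>. In the limit \<open>\<alpha> \<rightarrow> 1\<close> the curvatures along the geodesic
  sum to at most \<open>2 - 2 * p\<close>. They sum to at least \<open>k * \<kappa>\<^sub>0 - I\<close>, since the edges of a geodesic are
  distinct. Hence \<open>p \<le> 1 + (I - k * \<kappa>\<^sub>0) / 2\<close>, which bounds the growth of spheres, and \<open>p \<ge> 0\<close> bounds the
  diameter.\<close>

text \<open>Needed because \<open>kappa_LLY\<close> is defined by \<open>Lim\<close>, which carries
  information only once convergence is known. The quotient in \<open>kappa_LLY\<close> is later
  shown to be monotone and bounded.\<close>

lemma tendsto_at_left_Sup:
  fixes g :: "real \<Rightarrow> real"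
  assumes "a < b" and mono: "mono_on {a..<b} g" and bdd: "bdd_above (g ` {a..<b})"
  shows "(g \<longlongrightarrow> Sup (g ` {a..<b})) (at_left b)"
proof (rule order_tendstoI)
  fix c assume "c < Sup (g ` {a..<b})"
  then obtain t where t: "t \<in> {a..<b}" "c < g t"
    using less_cSup_iff[OF _ bdd] \<open>a < b\<close> by auto
  have "\<forall>\<^sub>F s in at_left b. s \<in> {t<..<b}"
    using t(1) by (intro eventually_at_left_real) auto
  then show "\<forall>\<^sub>F s in at_left b. c < g s"
  proof eventually_elim
    case (elim s)
    with t(1) have "g t \<le> g s" by (intro mono_onD[OF mono]) auto
    with t(2) show ?case by simp
  qed
next
  fix c assume c: "Sup (g ` {a..<b}) < c"
  have "\<forall>\<^sub>F s in at_left b. s \<in> {a<..<b}"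
    using \<open>a < b\<close> by (rule eventually_at_left_real)
  then show "\<forall>\<^sub>F s in at_left b. g s < c"
  proof eventually_elim
    case (elim s)
    then have "g s \<le> Sup (g ` {a..<b})" by (intro cSup_upper bdd) auto
    with c show ?case by simp
  qed
qed

section \<open>Couplings and the transportation distance\<close>

lemma coupling_product:
  assumes "finite V"
    and "\<And>v. v \<in> V \<Longrightarrow> 0 \<le> m1 v" "(\<Sum>v\<in>V. m1 v) = 1"
    and "\<And>v. v \<in> V \<Longrightarrow> 0 \<le> m2 v" "(\<Sum>v\<in>V. m2 v) = 1"
  shows "coupling V m1 m2 (\<lambda>u v. m1 u * m2 v)"
proof -
  have "m1 v \<le> 1" "m2 v \<le> 1" if "v \<in> V" for v
    using member_le_sum[of v V m1] member_le_sum[of v V m2] assms that by auto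
  then show ?thesis
    using assms by (auto simp: coupling_def mult_le_one simp flip: sum_distrib_left sum_distrib_right)
qed

text \<open>The matrix mixes \<open>A\<close> with the point mass at \<open>(x, y)\<close>, and
  marginals mix accordingly. Making a lazy walk lazier is a mixture of this kind, which is where
  concavity of \<open>kappa\<close> in the laziness comes from.\<close>

lemma coupling_mix_dirac:
  assumes "finite V" "coupling V m1 m2 A" "x \<in> V" "y \<in> V" "0 \<le> l" "l \<le> 1"
    and "\<And>v. v \<in> V \<Longrightarrow> m1' v = l * m1 v + (1 - l) * of_bool (v = x)"
    and "\<And>v. v \<in> V \<Longrightarrow> m2' v = l * m2 v + (1 - l) * of_bool (v = y)"
  shows "coupling V m1' m2' (\<lambda>u v. l * A u v + (1 - l) * of_bool (u = x \<and> v = y))"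
proof -
  have A: "A u v \<in> {0..1}" if "u \<in> V" "v \<in> V" for u v
    using assms that by (auto simp: coupling_def)
  have "l * A u v + (1 - l) * of_bool (u = x \<and> v = y) \<le> 1" if "u \<in> V" "v \<in> V" for u v
  proof -
    have "l * A u v \<le> l * 1" using A[OF that] assms by (intro mult_left_mono) auto
    moreover have "(1 - l) * of_bool (u = x \<and> v = y) \<le> 1 - l" using assms by auto
    ultimately show ?thesis by simp
  qed
  moreover have "(\<Sum>v\<in>V. l * A u v + (1 - l) * of_bool (u = x \<and> v = y)) = m1' u" if "u \<in> V" for u
  proof -
    have "(\<Sum>v\<in>V. (of_bool (u = x \<and> v = y) :: real)) = of_bool (u = x)"
      using assms(1,4) by (cases "u = x") (auto simp: of_bool_def)
    then show ?thesis
      using assms that by (simp add: sum.distrib coupling_def flip: sum_distrib_left)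
  qed
  moreover have "(\<Sum>u\<in>V. l * A u v + (1 - l) * of_bool (u = x \<and> v = y)) = m2' v" if "v \<in> V" for v
  proof -
    have "(\<Sum>u\<in>V. (of_bool (u = x \<and> v = y) :: real)) = of_bool (v = y)"
      using assms(1,3) by (cases "v = y") (auto simp: of_bool_def)
    then show ?thesis
      using assms that by (simp add: sum.distrib coupling_def flip: sum_distrib_left)
  qed
  ultimately show ?thesis
    using A assms by (auto simp: coupling_def)
qed

lemma transport_dist_le:
  assumes "coupling V m1 m2 A"
  shows "transport_dist V E m1 m2 \<le> (\<Sum>x\<in>V. \<Sum>y\<in>V. A x y * real (gdist V E x y))"
  unfolding transport_dist_def
proof (rule cInf_lower)
  show "bdd_below {\<Sum>x\<in>V. \<Sum>y\<in>V. A x y * real (gdist V E x y) |A. coupling V m1 m2 A}"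
    by (rule bdd_belowI[of _ 0]) (auto simp: coupling_def intro!: sum_nonneg)
qed (use assms in auto)

text \<open>The easy half of Kantorovich duality: integrate \<open>f v - f u\<close> against an
  arbitrary coupling. The given \<open>A\<close> only ensures that the infimum is over a nonempty
  set.\<close>

lemma transport_dist_ge_Lipschitz:
  assumes "coupling V m1 m2 A"
    and lip: "\<And>u v. u \<in> V \<Longrightarrow> v \<in> V \<Longrightarrow> f v - f u \<le> real (gdist V E u v)"
  shows "(\<Sum>v\<in>V. f v * m2 v) - (\<Sum>v\<in>V. f v * m1 v) \<le> transport_dist V E m1 m2"
  unfolding transport_dist_def
proof (rule cInf_greatest, use assms(1) in blast, clarify)
  fix B assume B: "coupling V m1 m2 B"
  have "(\<Sum>v\<in>V. f v * m2 v) = (\<Sum>v\<in>V. \<Sum>u\<in>V. B u v * f v)"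
    using B by (intro sum.cong) (auto simp: coupling_def mult.commute simp flip: sum_distrib_left sum_distrib_right)
  moreover have "(\<Sum>u\<in>V. f u * m1 u) = (\<Sum>u\<in>V. \<Sum>v\<in>V. B u v * f u)"
    using B by (intro sum.cong) (auto simp: coupling_def mult.commute simp flip: sum_distrib_left sum_distrib_right)
  ultimately have "(\<Sum>v\<in>V. f v * m2 v) - (\<Sum>v\<in>V. f v * m1 v) = (\<Sum>u\<in>V. \<Sum>v\<in>V. B u v * (f v - f u))"
    by (subst (asm) sum.swap) (simp add: right_diff_distrib sum_subtractf)
  also have "\<dots> \<le> (\<Sum>u\<in>V. \<Sum>v\<in>V. B u v * real (gdist V E u v))"
    using B lip by (intro sum_mono mult_left_mono) (auto simp: coupling_def)
  finally show "(\<Sum>v\<in>V. f v * m2 v) - (\<Sum>v\<in>V. f v * m1 v)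
    \<le> (\<Sum>u\<in>V. \<Sum>v\<in>V. B u v * real (gdist V E u v))" .
qed

section \<open>Walks and distances in a connected graph\<close>

locale finite_connected_graph =
  fixes V :: "'a set" and E :: "'a set set"
  assumes graph: "finite_simple_graph V E" and conn: "connected_graph V E"
begin

abbreviation "dist' \<equiv> gdist V E"

lemma finite_V: "finite V"
  using graph by (simp add: finite_simple_graph_def)

lemma finite_E: "finite E"
  using graph by (intro finite_subset[of E "Pow V"]) (auto simp: finite_simple_graph_def)

lemma edgeD:
  assumes "{u, v} \<in> E" shows "u \<in> V" "v \<in> V" "u \<noteq> v"
  using graph assms by (auto simp: finite_simple_graph_def dest!: bspec)

lemma nbhd_subset: "nbhd E x \<subseteq> V"
  by (auto simp: nbhd_def dest: edgeD)

lemma finite_nbhd: "finite (nbhd E x)"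
  using finite_subset[OF nbhd_subset finite_V] .

lemma deg_pos:
  assumes "{x, y} \<in> E" shows "0 < deg E x" "0 < deg E y"
  using assms finite_nbhd[of x] finite_nbhd[of y]
  by (auto simp: deg_def card_gt_0_iff nbhd_def insert_commute)

lemma shortest_walk:
  assumes "x \<in> V" "y \<in> V"
  obtains xs where "walk V E x xs y" "length xs = Suc (dist' x y)"
proof -
  obtain xs where xs: "walk V E x xs y" using conn assms by (auto simp: connected_graph_def)
  then have "length xs = Suc (length xs - 1)" by (simp add: walk_def)
  with xs have "\<exists>xs. walk V E x xs y \<and> length xs = Suc (dist' x y)"
    unfolding gdist_def by (intro LeastI_ex[of "\<lambda>k. \<exists>xs. walk V E x xs y \<and> length xs = Suc k"]) blast
  with that show thesis by blast
qed

lemma dist_le: "walk V E x xs y \<Longrightarrow> length xs = Suc k \<Longrightarrow> dist' x y \<le> k"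
  unfolding gdist_def by (rule Least_le) blast

lemma dist_self: "x \<in> V \<Longrightarrow> dist' x x = 0"
  using dist_le[of x "[x]" x 0] by (simp add: walk_def)

lemma dist_eq_0D:
  assumes "x \<in> V" "y \<in> V" "dist' x y = 0" shows "x = y"
proof -
  obtain xs where "walk V E x xs y" "length xs = Suc 0"
    using shortest_walk[OF assms(1,2)] assms(3) by metis
  then show ?thesis by (auto simp: walk_def length_Suc_conv)
qed

lemma dist_step:
  assumes "x \<in> V" "{y, z} \<in> E" shows "dist' x z \<le> Suc (dist' x y)"
proof -
  obtain xs where "walk V E x xs y" "length xs = Suc (dist' x y)"
    using shortest_walk assms edgeD by metis
  then have "walk V E x (xs @ [z]) z" "length (xs @ [z]) = Suc (Suc (dist' x y))"
    using assms edgeD[of y z] by (auto simp: walk_def successively_append_iff)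
  then show ?thesis by (rule dist_le)
qed

text \<open>Drop the last vertex of a shortest walk; by \<open>dist_step\<close> its new end point
  cannot be closer to \<open>x\<close> than \<open>k\<close>.\<close>

lemma dist_pred:
  assumes "x \<in> V" "y \<in> V" "dist' x y = Suc k"
  obtains z where "z \<in> V" "{z, y} \<in> E" "dist' x z = k"
proof -
  obtain xs where xs: "walk V E x xs y" "length xs = Suc (Suc k)"
    using shortest_walk[OF assms(1,2)] assms(3) by metis
  define ys where "ys = butlast xs"
  have xs_eq: "xs = ys @ [y]" and ys: "length ys = Suc k" "ys \<noteq> []"
    using xs by (auto simp: ys_def walk_def simp flip: length_greater_0_conv)
  have edge: "{last ys, y} \<in> E" and walk: "walk V E x ys (last ys)"
    using xs(1) ys(2) unfolding xs_eq walk_def by (auto simp: successively_append_iff)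
  have "dist' x (last ys) \<le> k" using walk ys(1) by (rule dist_le)
  moreover have "Suc k \<le> Suc (dist' x (last ys))" using dist_step[OF assms(1) edge] assms(3) by simp
  ultimately show thesis using that edge edgeD(1) by (metis Suc_le_mono le_antisym)
qed

lemma dist_edge:
  assumes "{x, y} \<in> E" shows "dist' x y = 1"
  using dist_step[of x x y] dist_self[of x] dist_eq_0D[of x y] edgeD[OF assms] assms
  by (cases "dist' x y") auto

text \<open>Peeling the last edge off a shortest walk reduces the Lipschitz condition to single
  edges.\<close>

lemma Lipschitz_dist:
  assumes lip: "\<And>u v. {u, v} \<in> E \<Longrightarrow> f v - f u \<le> (1 :: real)"
    and "u \<in> V" "v \<in> V"
  shows "f v - f u \<le> real (dist' u v)"
  using \<open>v \<in> V\<close>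
proof (induction "dist' u v" arbitrary: v)
  case 0
  then show ?case using dist_eq_0D \<open>u \<in> V\<close> by (metis diff_self of_nat_0 order_refl)
next
  case (Suc k)
  then obtain z where z: "z \<in> V" "{z, v} \<in> E" "dist' u z = k"
    using dist_pred \<open>u \<in> V\<close> by metis
  have "f z - f u \<le> real (dist' u z)" using Suc.hyps(1)[of z] z by simp
  moreover have "f v - f z \<le> 1" using lip z by simp
  ultimately show ?case using z Suc.hyps(2) by simp
qed

section \<open>Lazy measures and the curvature of an edge\<close>

lemma lazy_measure_eq:
  "lazy_measure E \<alpha> x v =
     \<alpha> * of_bool (v = x) + (1 - \<alpha>) / real (deg E x) * of_bool (v \<in> nbhd E x)"
  using edgeD(3)[of x x] by (auto simp: lazy_measure_def nbhd_def)

lemma sum_lazy_measure: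
  assumes "x \<in> V"
  shows "(\<Sum>v\<in>V. f v * lazy_measure E \<alpha> x v) =
    \<alpha> * f x + (1 - \<alpha>) * ((\<Sum>v\<in>nbhd E x. f v) / real (deg E x))"
proof -
  let ?c = "(1 - \<alpha>) / real (deg E x)"
  have "(\<Sum>v\<in>V. f v * lazy_measure E \<alpha> x v) =
      (\<Sum>v\<in>V. if v = x then \<alpha> * f v else 0) + (\<Sum>v\<in>V. if v \<in> nbhd E x then ?c * f v else 0)"
    unfolding lazy_measure_eq sum.distrib[symmetric]
    by (intro sum.cong) (auto simp: algebra_simps)
  also have "(\<Sum>v\<in>V. if v = x then \<alpha> * f v else 0) = \<alpha> * f x"
    using assms finite_V by simp
  also have "(\<Sum>v\<in>V. if v \<in> nbhd E x then ?c * f v else 0) = (\<Sum>v\<in>nbhd E x. ?c * f v)"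
    using nbhd_subset[of x] finite_V by (simp add: Int_absorb1 flip: sum.inter_restrict)
  finally show ?thesis by (simp add: sum_distrib_left sum_divide_distrib)
qed

text \<open>The product measure is a coupling. The edge gives both end points positive degree, so
  that the lazy measures have total mass 1.\<close>

lemma lazy_coupling:
  assumes "{x, y} \<in> E" "0 \<le> \<alpha>" "\<alpha> \<le> 1"
  obtains A where "coupling V (lazy_measure E \<alpha> x) (lazy_measure E \<alpha> y) A"
proof
  have "(\<Sum>v\<in>V. lazy_measure E \<alpha> z v) = 1" if "z \<in> {x, y}" for z
    using sum_lazy_measure[of z "\<lambda>_. 1" \<alpha>] that edgeD[OF assms(1)] deg_pos[OF assms(1)]
    by (auto simp: deg_def)
  then show "coupling V (lazy_measure E \<alpha> x) (lazy_measure E \<alpha> y)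
      (\<lambda>u v. lazy_measure E \<alpha> x u * lazy_measure E \<alpha> y v)"
    using assms by (intro coupling_product finite_V) (auto simp: lazy_measure_def)
qed

text \<open>Duality with an arbitrary test function, so that one \<open>f\<close> can serve every
  edge of a geodesic. No denominator remains because adjacent vertices are at distance 1.\<close>

lemma kappa_edge_le:
  assumes edge: "{x, y} \<in> E" and \<alpha>: "0 \<le> \<alpha>" "\<alpha> \<le> 1"
    and lip: "\<And>u v. {u, v} \<in> E \<Longrightarrow> f v - f u \<le> (1 :: real)"
  shows "kappa V E \<alpha> x y \<le>
    1 - ((\<Sum>v\<in>V. f v * lazy_measure E \<alpha> y v) - (\<Sum>v\<in>V. f v * lazy_measure E \<alpha> x v))"
proof -
  obtain A where "coupling V (lazy_measure E \<alpha> x) (lazy_measure E \<alpha> y) A"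
    using lazy_coupling edge \<alpha> by blast
  from transport_dist_ge_Lipschitz[where f = f and E = E, OF this Lipschitz_dist[of f, OF lip]]
  show ?thesis by (simp add: kappa_def dist_edge[OF edge])
qed

text \<open>Concavity of \<open>\<alpha> \<mapsto> kappa V E \<alpha> x y\<close>, which vanishes at \<open>\<alpha> = 1\<close>.\<close>

lemma kappa_quotient_mono:
  assumes edge: "{x, y} \<in> E" and "0 \<le> \<alpha>" "\<alpha> \<le> \<beta>" "\<beta> < 1"
  shows "kappa V E \<alpha> x y / (1 - \<alpha>) \<le> kappa V E \<beta> x y / (1 - \<beta>)"
proof -
  \<comment> \<open>With this weight the \<beta>-lazy measure is \<open>l\<close> times the
    \<alpha>-lazy one plus mass \<open>1 - l\<close> at the centre.\<close>
  define l where "l = (1 - \<beta>) / (1 - \<alpha>)"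
  have l: "0 < l" "l \<le> 1" "l * (1 - \<alpha>) = 1 - \<beta>" using assms by (auto simp: l_def)
  let ?W = "\<lambda>\<alpha>. transport_dist V E (lazy_measure E \<alpha> x) (lazy_measure E \<alpha> y)"
  have mix: "lazy_measure E \<beta> z v = l * lazy_measure E \<alpha> z v + (1 - l) * of_bool (v = z)" for z v
  proof -
    have "\<beta> = l * \<alpha> + (1 - l)" using l(3) by (simp add: algebra_simps)
    then show ?thesis
      unfolding lazy_measure_eq l(3)[symmetric] by (auto simp: algebra_simps)
  qed
  \<comment> \<open>Isolating \<open>?W \<alpha>\<close> lets \<open>cInf_greatest\<close> reduce
    the claim to an arbitrary coupling of the \<alpha>-lazy measures.\<close>
  have "(?W \<beta> - (1 - l)) / l \<le> ?W \<alpha>"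
    unfolding transport_dist_def[of V E "lazy_measure E \<alpha> x"]
  proof (rule cInf_greatest)
    show "{\<Sum>u\<in>V. \<Sum>v\<in>V. A u v * real (dist' u v) |A.
        coupling V (lazy_measure E \<alpha> x) (lazy_measure E \<alpha> y) A} \<noteq> {}"
      using lazy_coupling[OF edge, of \<alpha>] assms by auto
  next
    fix c assume "c \<in> {\<Sum>u\<in>V. \<Sum>v\<in>V. A u v * real (dist' u v) |A.
        coupling V (lazy_measure E \<alpha> x) (lazy_measure E \<alpha> y) A}"
    then obtain A where A: "coupling V (lazy_measure E \<alpha> x) (lazy_measure E \<alpha> y) A"
      and c: "c = (\<Sum>u\<in>V. \<Sum>v\<in>V. A u v * real (dist' u v))" by blast
    \<comment> \<open>The added mass \<open>1 - l\<close> travels from \<open>x\<close> to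
      \<open>y\<close> along the edge, at cost \<open>1 - l\<close>.\<close>
    let ?B = "\<lambda>u v. l * A u v + (1 - l) * of_bool (u = x \<and> v = y)"
    have "?W \<beta> \<le> (\<Sum>u\<in>V. \<Sum>v\<in>V. ?B u v * real (dist' u v))"
      using l edgeD[OF edge] by (intro transport_dist_le coupling_mix_dirac[OF finite_V A] mix) auto
    also have "\<dots> = (\<Sum>u\<in>V. \<Sum>v\<in>V. l * (A u v * real (dist' u v)) +
        (if v = y then if u = x then 1 - l else 0 else 0))"
      by (intro sum.cong) (auto simp: algebra_simps dist_edge[OF edge])
    also have "\<dots> = l * c + (1 - l)"
      using edgeD[OF edge] finite_V by (simp add: sum.distrib c sum_distrib_left)
    finally show "(?W \<beta> - (1 - l)) / l \<le> c" using l by (simp add: field_simps)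
  qed
  then have "l * kappa V E \<alpha> x y \<le> kappa V E \<beta> x y"
    using l by (simp add: kappa_def dist_edge[OF edge] field_simps)
  then show ?thesis using assms l by (simp add: l_def field_simps)
qed

text \<open>Test with the distance from \<open>x\<close>. Its mean is at least \<alpha> around
  \<open>y\<close>, where \<open>y\<close> alone contributes \<alpha>, and exactly 1 - \<alpha>
  around \<open>x\<close>; hence \<open>kappa\<close> is at most 2 (1 - \<alpha>).\<close>

lemma kappa_edge_le_2:
  assumes edge: "{x, y} \<in> E" and \<alpha>: "0 \<le> \<alpha>" "\<alpha> < 1"
  shows "kappa V E \<alpha> x y / (1 - \<alpha>) \<le> 2"
proof -
  have x: "x \<in> V" and y: "y \<in> V" using edgeD[OF edge] by auto
  define f where "f v = real (dist' x v)" for v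
  have lip: "f v - f u \<le> 1" if "{u, v} \<in> E" for u v
    using dist_step[OF x that] by (simp add: f_def)
  have "kappa V E \<alpha> x y \<le>
      1 - ((\<Sum>v\<in>V. f v * lazy_measure E \<alpha> y v) - (\<Sum>v\<in>V. f v * lazy_measure E \<alpha> x v))"
    using \<alpha> by (intro kappa_edge_le[OF edge] lip) auto
  moreover have "0 \<le> (\<Sum>v\<in>nbhd E y. f v) / real (deg E y)"
    by (intro divide_nonneg_nonneg sum_nonneg) (auto simp: f_def)
  then have "\<alpha> \<le> (\<Sum>v\<in>V. f v * lazy_measure E \<alpha> y v)"
    using \<alpha> mult_nonneg_nonneg[of "1 - \<alpha>" "(\<Sum>v\<in>nbhd E y. f v) / real (deg E y)"]
    by (simp add: sum_lazy_measure[OF y] f_def[of y] dist_edge[OF edge])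
  moreover have "(\<Sum>v\<in>nbhd E x. f v) = (\<Sum>v\<in>nbhd E x. 1)"
    by (intro sum.cong refl) (simp add: f_def nbhd_def dist_edge insert_commute)
  then have "(\<Sum>v\<in>V. f v * lazy_measure E \<alpha> x v) = 1 - \<alpha>"
    using deg_pos(1)[OF edge] by (simp add: sum_lazy_measure[OF x] f_def[of x] dist_self[OF x] deg_def)
  ultimately show ?thesis using \<alpha> by (simp add: field_simps)
qed

text \<open>The quotient increases with \<alpha> and stays below 2, so its supremum is the limit,
  and \<open>Lim\<close> returns it.\<close>

lemma kappa_LLY_limit:
  assumes edge: "{x, y} \<in> E"
  shows "((\<lambda>\<alpha>. kappa V E \<alpha> x y / (1 - \<alpha>)) \<longlongrightarrow> kappa_LLY V E x y) (at_left 1)"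
proof -
  let ?g = "\<lambda>\<alpha>. kappa V E \<alpha> x y / (1 - \<alpha>)"
  have "(?g \<longlongrightarrow> Sup (?g ` {0..<1})) (at_left 1)"
  proof (rule tendsto_at_left_Sup)
    show "mono_on {0..<1} ?g"
      using kappa_quotient_mono[OF edge] by (intro mono_onI) auto
    show "bdd_above (?g ` {0..<1})"
      using kappa_edge_le_2[OF edge] by (intro bdd_aboveI[of _ 2]) auto
  qed simp
  with tendsto_Lim[OF trivial_limit_at_left_real this] show ?thesis
    by (simp add: kappa_LLY_def)
qed

section \<open>Curvature along geodesics\<close>

lemma geodesic:
  assumes "x \<in> V" "y \<in> V"
  obtains p where "p 0 = x" "p (dist' x y) = y"
    "\<forall>i<dist' x y. {p i, p (Suc i)} \<in> E"
    "\<forall>i\<le>dist' x y. p i \<in> V \<and> dist' x (p i) = i"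
proof -
  have "\<exists>p. p 0 = x \<and> p k = y \<and> (\<forall>i<k. {p i, p (Suc i)} \<in> E) \<and>
      (\<forall>i\<le>k. p i \<in> V \<and> dist' x (p i) = i)" if "y \<in> V" "dist' x y = k" for k y
    using that
  proof (induction k arbitrary: y)
    case 0
    then show ?case using dist_eq_0D[of x y] \<open>x \<in> V\<close> by (intro exI[of _ "\<lambda>_. x"]) auto
  next
    case (Suc k)
    then obtain z where z: "z \<in> V" "{z, y} \<in> E" "dist' x z = k" using dist_pred \<open>x \<in> V\<close> by metis
    then obtain p where p: "p 0 = x" "p k = z" "\<forall>i<k. {p i, p (Suc i)} \<in> E"
      "\<forall>i\<le>k. p i \<in> V \<and> dist' x (p i) = i" using Suc.IH by metis
    then show ?case
      using z Suc.prems by (intro exI[of _ "p(Suc k := y)"]) (auto simp: less_Suc_eq le_Suc_eq)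
  qed
  then show thesis using that assms by metis
qed

lemma rho_edge_nonneg: "e \<in> E \<Longrightarrow> 0 \<le> rho_edge V E \<kappa>\<^sub>0 e"
proof -
  assume "e \<in> E"
  then obtain x y where "e = {x, y}"
    using graph by (auto simp: finite_simple_graph_def card_2_iff dest!: bspec)
  then show ?thesis by (simp add: rho_edge_doubleton rho_def)
qed

text \<open>Each curvature is at least \<open>\<kappa>\<^sub>0 - rho\<close>, and since the edges of
  a geodesic are distinct, the \<open>rho\<close> terms form part of the sum over all of
  \<open>E\<close>.\<close>

lemma sum_kappa_LLY_ge:
  assumes edge: "\<And>i. i < k \<Longrightarrow> {p i, p (Suc i)} \<in> E"
    and dist: "\<And>i. i \<le> k \<Longrightarrow> dist' (p 0) (p i) = i"
  shows "real k * \<kappa>\<^sub>0 - curv_deficit V E \<kappa>\<^sub>0 \<le> (\<Sum>i<k. kappa_LLY V E (p i) (p (Suc i)))"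
proof -
  have inj: "inj_on (\<lambda>i. {p i, p (Suc i)}) {..<k}"
  proof (rule inj_onI)
    fix i j assume ij: "i \<in> {..<k}" "j \<in> {..<k}" "{p i, p (Suc i)} = {p j, p (Suc j)}"
    \<comment> \<open>Distances from the start turn the two edges into \<open>{i, Suc i}\<close> and
      \<open>{j, Suc j}\<close>, which determine the indices.\<close>
    have "dist' (p 0) ` {p i, p (Suc i)} = dist' (p 0) ` {p j, p (Suc j)}"
      using ij(3) by (rule arg_cong)
    then have "{i, Suc i} = {j, Suc j}"
      using ij(1,2) by (simp add: dist)
    then show "i = j" by (auto simp: doubleton_eq_iff)
  qed
  have "(\<Sum>i<k. rho V E \<kappa>\<^sub>0 (p i) (p (Suc i))) = (\<Sum>i<k. rho_edge V E \<kappa>\<^sub>0 {p i, p (Suc i)})"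
    by (simp add: rho_edge_doubleton)
  also have "\<dots> = (\<Sum>e\<in>(\<lambda>i. {p i, p (Suc i)}) ` {..<k}. rho_edge V E \<kappa>\<^sub>0 e)"
    using inj by (simp add: sum.reindex)
  also have "\<dots> \<le> curv_deficit V E \<kappa>\<^sub>0"
    unfolding curv_deficit_def using edge rho_edge_nonneg by (intro sum_mono2 finite_E) auto
  finally have "(\<Sum>i<k. rho V E \<kappa>\<^sub>0 (p i) (p (Suc i))) \<le> curv_deficit V E \<kappa>\<^sub>0" .
  moreover have "(\<Sum>i<k. \<kappa>\<^sub>0 - rho V E \<kappa>\<^sub>0 (p i) (p (Suc i))) \<le> (\<Sum>i<k. kappa_LLY V E (p i) (p (Suc i)))"
    by (intro sum_mono) (simp add: rho_def)
  ultimately show ?thesis by (simp add: sum_subtractf)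
qed

definition outer_nbhd :: "'a \<Rightarrow> 'a \<Rightarrow> 'a set" where
  "outer_nbhd x y = {v \<in> nbhd E y. dist' x v = Suc (dist' x y)}"

text \<open>With the distance from \<open>p 0\<close> as common test function only the means around
  the two ends survive. The bound found for each \<alpha> has the factor 1 - \<alpha>, which the
  quotient cancels before the limit is taken.\<close>

lemma sum_kappa_LLY_le:
  assumes edge: "\<And>i. i < k \<Longrightarrow> {p i, p (Suc i)} \<in> E" and "0 < k"
    and dist: "\<And>i. i \<le> k \<Longrightarrow> dist' (p 0) (p i) = i"
  shows "(\<Sum>i<k. kappa_LLY V E (p i) (p (Suc i))) \<le>
    2 - 2 * (real (card (outer_nbhd (p 0) (p k))) / real (deg E (p k)))"
proof -
  define x y where "x = p 0" and "y = p k"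
  have x: "x \<in> V" "0 < deg E x" using edge[of 0] edgeD deg_pos \<open>0 < k\<close> by (auto simp: x_def)
  have y: "y \<in> V" "0 < deg E y"
    using edge[of "k - 1"] edgeD deg_pos \<open>0 < k\<close> by (auto simp: y_def)
  have xy: "dist' x y = k" using dist[of k] by (simp add: x_def y_def)
  define f where "f v = real (dist' x v)" for v
  have lip: "f v - f u \<le> 1" if "{u, v} \<in> E" for u v
    using dist_step[OF x(1) that] by (simp add: f_def)
  \<comment> \<open>This is the proportion of farther neighbours from the overview; here
    \<open>p\<close> denotes the path.\<close>
  define q where "q = real (card (outer_nbhd x y)) / real (deg E y)"
  have fx: "(\<Sum>v\<in>V. f v * lazy_measure E \<alpha> x v) = 1 - \<alpha>" for \<alpha>
  proof -
    have "(\<Sum>v\<in>nbhd E x. f v) = (\<Sum>v\<in>nbhd E x. 1)"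
      by (intro sum.cong refl) (simp add: f_def nbhd_def dist_edge insert_commute)
    then show ?thesis
      using x by (simp add: sum_lazy_measure f_def[of x] dist_self deg_def)
  qed
  \<comment> \<open>A neighbour of \<open>y\<close> is at distance at least \<open>k - 1\<close>
    from \<open>x\<close>; the outer ones are at distance \<open>k + 1\<close>, a gain of 2.\<close>
  have "(\<Sum>v\<in>nbhd E y. real k - 1 + 2 * of_bool (v \<in> outer_nbhd x y)) \<le> (\<Sum>v\<in>nbhd E y. f v)"
  proof (rule sum_mono)
    fix v assume v: "v \<in> nbhd E y"
    show "real k - 1 + 2 * of_bool (v \<in> outer_nbhd x y) \<le> f v"
    proof (cases "v \<in> outer_nbhd x y")
      case True
      then show ?thesis by (simp add: outer_nbhd_def f_def xy)
    next
      case False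
      then show ?thesis using lip[of v y] v by (simp add: nbhd_def f_def xy)
    qed
  qed
  also have "(\<Sum>v\<in>nbhd E y. real k - 1 + 2 * of_bool (v \<in> outer_nbhd x y)) =
      real (deg E y) * (real k - 1) + 2 * real (card (outer_nbhd x y))"
  proof -
    have "outer_nbhd x y \<subseteq> nbhd E y" by (auto simp: outer_nbhd_def)
    then have "(\<Sum>v\<in>nbhd E y. of_bool (v \<in> outer_nbhd x y) :: real) = real (card (outer_nbhd x y))"
      using finite_nbhd[of y] by (simp add: sum_of_bool_eq Int_absorb1 Collect_conj_eq Int_def[symmetric])
    then show ?thesis by (simp add: sum.distrib deg_def flip: sum_distrib_left)
  qed
  finally have "(real (deg E y) * (real k - 1) + 2 * real (card (outer_nbhd x y))) / real (deg E y)
      \<le> (\<Sum>v\<in>nbhd E y. f v) / real (deg E y)"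
    by (rule divide_right_mono) simp
  then have fy: "real k - 1 + 2 * q \<le> (\<Sum>v\<in>nbhd E y. f v) / real (deg E y)"
    using y(2) by (simp add: q_def add_divide_distrib)
  have bound: "(\<Sum>i<k. kappa V E \<alpha> (p i) (p (Suc i)) / (1 - \<alpha>)) \<le> 2 - 2 * q"
    if \<alpha>: "0 < \<alpha>" "\<alpha> < 1" for \<alpha>
  proof -
    let ?F = "\<lambda>z. \<Sum>v\<in>V. f v * lazy_measure E \<alpha> z v"
    have "(\<Sum>i<k. kappa V E \<alpha> (p i) (p (Suc i))) \<le> (\<Sum>i<k. 1 - (?F (p (Suc i)) - ?F (p i)))"
      using kappa_edge_le[OF edge, of _ \<alpha> f] lip \<alpha> by (intro sum_mono) auto
    \<comment> \<open>The means at interior vertices of the path cancel.\<close>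
    also have "\<dots> = real k - (?F y - ?F x)"
      using sum_lessThan_telescope[of "\<lambda>i. ?F (p i)" k]
      by (simp add: sum_subtractf[of "\<lambda>_. 1"] x_def y_def)
    also have "?F y = \<alpha> * real k + (1 - \<alpha>) * ((\<Sum>v\<in>nbhd E y. f v) / real (deg E y))"
      using y(1) by (simp add: sum_lazy_measure f_def xy)
    also have "real k - (\<dots> - ?F x) \<le>
        real k - (\<alpha> * real k + (1 - \<alpha>) * (real k - 1 + 2 * q) - ?F x)"
      using mult_left_mono[OF fy, of "1 - \<alpha>"] \<alpha> by simp
    also have "\<dots> = (1 - \<alpha>) * (2 - 2 * q)"
      by (simp add: fx algebra_simps)
    finally show ?thesis using \<alpha> by (simp add: field_simps flip: sum_divide_distrib)
  qed
  have "(\<Sum>i<k. kappa_LLY V E (p i) (p (Suc i))) \<le> 2 - 2 * q"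
  proof (rule tendsto_upperbound)
    show "((\<lambda>\<alpha>. \<Sum>i<k. kappa V E \<alpha> (p i) (p (Suc i)) / (1 - \<alpha>)) \<longlongrightarrow>
        (\<Sum>i<k. kappa_LLY V E (p i) (p (Suc i)))) (at_left 1)"
      using kappa_LLY_limit[OF edge] by (intro tendsto_sum) auto
    show "\<forall>\<^sub>F \<alpha> in at_left 1. (\<Sum>i<k. kappa V E \<alpha> (p i) (p (Suc i)) / (1 - \<alpha>)) \<le> 2 - 2 * q"
      using eventually_at_left_real[of 0 1] by (rule eventually_mono) (auto intro: bound)
  qed simp
  then show ?thesis by (simp add: q_def x_def y_def)
qed

text \<open>Compare the two estimates of the curvature sum along one geodesic. Since the left side
  is nonnegative, this bounds distances as well as sphere growth.\<close>

lemma outer_nbhd_bound: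
  assumes "x \<in> V" "y \<in> V" "x \<noteq> y"
  shows "real (card (outer_nbhd x y)) / real (deg E y) \<le>
    1 + (curv_deficit V E \<kappa>\<^sub>0 - real (dist' x y) * \<kappa>\<^sub>0) / 2"
proof -
  obtain p where p: "p 0 = x" "p (dist' x y) = y"
    "\<forall>i<dist' x y. {p i, p (Suc i)} \<in> E"
    "\<forall>i\<le>dist' x y. p i \<in> V \<and> dist' x (p i) = i"
    by (rule geodesic[OF assms(1,2)])
  have "0 < dist' x y" using dist_eq_0D assms by blast
  then have "(\<Sum>i<dist' x y. kappa_LLY V E (p i) (p (Suc i))) \<le>
      2 - 2 * (real (card (outer_nbhd x y)) / real (deg E y))"
    using sum_kappa_LLY_le[of "dist' x y" p] p by simp
  moreover have "real (dist' x y) * \<kappa>\<^sub>0 - curv_deficit V E \<kappa>\<^sub>0 \<le>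
      (\<Sum>i<dist' x y. kappa_LLY V E (p i) (p (Suc i)))"
    using p by (intro sum_kappa_LLY_ge) simp_all
  ultimately show ?thesis by argo
qed

section \<open>Growth of distance spheres\<close>

lemma deg_le_max_deg: "y \<in> V \<Longrightarrow> deg E y \<le> max_deg V E"
  using finite_V by (simp add: max_deg_def)

definition gsphere :: "'a \<Rightarrow> nat \<Rightarrow> 'a set" where
  "gsphere x k = {y \<in> V. dist' x y = k}"

lemma finite_sphere: "finite (gsphere x k)"
  using finite_V by (simp add: gsphere_def)

lemma sphere_0: "x \<in> V \<Longrightarrow> gsphere x 0 = {x}"
  using dist_self dist_eq_0D by (auto simp: gsphere_def)

text \<open>Every vertex of the larger sphere is an outer neighbour of a predecessor in the smaller
  one; apply the union bound.\<close>

lemma card_sphere_Suc_le: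
  assumes "x \<in> V"
  shows "card (gsphere x (Suc k)) \<le> (\<Sum>y\<in>gsphere x k. card (outer_nbhd x y))"
proof -
  have "gsphere x (Suc k) \<subseteq> (\<Union>y\<in>gsphere x k. outer_nbhd x y)"
  proof
    fix v assume v: "v \<in> gsphere x (Suc k)"
    then obtain z where "z \<in> V" "{z, v} \<in> E" "dist' x z = k"
      using dist_pred[OF assms, of v k] by (auto simp: gsphere_def)
    with v show "v \<in> (\<Union>y\<in>gsphere x k. outer_nbhd x y)"
      by (auto simp: gsphere_def outer_nbhd_def nbhd_def insert_commute)
  qed
  moreover have "finite (outer_nbhd x y)" for y
    using finite_nbhd by (simp add: outer_nbhd_def)
  ultimately have "card (gsphere x (Suc k)) \<le> card (\<Union>y\<in>gsphere x k. outer_nbhd x y)"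
    using finite_sphere by (intro card_mono) auto
  then show ?thesis using card_UN_le[OF finite_sphere] by (rule le_trans)
qed

text \<open>Factor \<open>i\<close> governs the step from radius \<open>i\<close> to
  \<open>i + 1\<close>. The first step, from the centre, uses the degree alone, so the product
  starts at 1. Nonempty spheres make the factors nonnegative, which multiplying the estimates
  requires.\<close>

lemma card_sphere_le:
  assumes x: "x \<in> V" and nonempty: "\<And>i. i \<le> k \<Longrightarrow> gsphere x i \<noteq> {}"
  shows "real (card (gsphere x (Suc k))) \<le> real (max_deg V E) ^ Suc k *
    (\<Prod>i = 1..k. 1 + (curv_deficit V E \<kappa>\<^sub>0 - real i * \<kappa>\<^sub>0) / 2)"
  using nonempty
proof (induction k)
  case 0
  have "card (outer_nbhd x x) \<le> deg E x"
    unfolding deg_def using finite_nbhd by (intro card_mono) (auto simp: outer_nbhd_def)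
  then have "card (gsphere x (Suc 0)) \<le> max_deg V E"
    using card_sphere_Suc_le[OF x, of 0] deg_le_max_deg[OF x] by (simp add: sphere_0 x)
  then show ?case by simp
next
  case (Suc k)
  let ?c = "1 + (curv_deficit V E \<kappa>\<^sub>0 - real (Suc k) * \<kappa>\<^sub>0) / 2"
  have q: "real (card (outer_nbhd x y)) / real (deg E y) \<le> ?c" if "y \<in> gsphere x (Suc k)" for y
    using that outer_nbhd_bound[OF x, of y \<kappa>\<^sub>0] dist_self[OF x]
    by (cases "x = y") (auto simp: gsphere_def)
  \<comment> \<open>Any vertex of the sphere will do: \<open>?c\<close> dominates its proportion of
    outer neighbours.\<close>
  have c: "0 \<le> ?c"
  proof -
    obtain y where "y \<in> gsphere x (Suc k)" using Suc.prems by blast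
    from q[OF this] show ?thesis by (rule order_trans[rotated]) simp
  qed
  have "real (card (gsphere x (Suc (Suc k)))) \<le> (\<Sum>y\<in>gsphere x (Suc k). real (card (outer_nbhd x y)))"
    using card_sphere_Suc_le[OF x, of "Suc k"] by (simp flip: of_nat_sum)
  also have "\<dots> \<le> (\<Sum>y\<in>gsphere x (Suc k). real (max_deg V E) * ?c)"
  proof (rule sum_mono)
    fix y assume y: "y \<in> gsphere x (Suc k)"
    then have "y \<in> V" "dist' x y = Suc k" by (auto simp: gsphere_def)
    then have "0 < deg E y" using dist_pred[OF x] deg_pos(2) by metis
    then have "real (card (outer_nbhd x y)) \<le> real (deg E y) * ?c"
      using q[OF y] by (simp add: pos_divide_le_eq mult.commute)
    also have "\<dots> \<le> real (max_deg V E) * ?c"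
      using deg_le_max_deg[OF \<open>y \<in> V\<close>] c by (intro mult_right_mono) auto
    finally show "real (card (outer_nbhd x y)) \<le> real (max_deg V E) * ?c" .
  qed
  also have "\<dots> = real (card (gsphere x (Suc k))) * (real (max_deg V E) * ?c)"
    by simp
  also have "\<dots> \<le> (real (max_deg V E) ^ Suc k *
      (\<Prod>i = 1..k. 1 + (curv_deficit V E \<kappa>\<^sub>0 - real i * \<kappa>\<^sub>0) / 2)) * (real (max_deg V E) * ?c)"
    using Suc.IH Suc.prems c by (intro mult_right_mono mult_nonneg_nonneg) auto
  also have "\<dots> = real (max_deg V E) ^ Suc (Suc k) *
      (\<Prod>i = 1..Suc k. 1 + (curv_deficit V E \<kappa>\<^sub>0 - real i * \<kappa>\<^sub>0) / 2)"
    by simp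
  finally show ?case .
qed

section \<open>The diameter and the number of vertices\<close>

lemma finite_dists: "finite {dist' x y |x y. x \<in> V \<and> y \<in> V}"
proof -
  have "{dist' x y |x y. x \<in> V \<and> y \<in> V} = (\<lambda>(x, y). dist' x y) ` (V \<times> V)" by auto
  then show ?thesis using finite_V by simp
qed

lemma dist_le_diam: "x \<in> V \<Longrightarrow> y \<in> V \<Longrightarrow> dist' x y \<le> diam V E"
  unfolding diam_def using finite_dists by (intro Max_ge) auto

lemma diam_attained:
  obtains x y where "x \<in> V" "y \<in> V" "dist' x y = diam V E"
proof -
  have "{dist' x y |x y. x \<in> V \<and> y \<in> V} \<noteq> {}"
    using conn unfolding connected_graph_def by blast
  from Max_in[OF finite_dists this] show thesis
    using that by (auto simp: diam_def)
qed

theorem card_le_diam: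
  "real (card V) \<le> 1 + (\<Sum>k = 1..diam V E. real (max_deg V E) ^ k *
     (\<Prod>i = 1..k - 1. 1 + (curv_deficit V E \<kappa>\<^sub>0 - real i * \<kappa>\<^sub>0) / 2))"
proof -
  \<comment> \<open>Centring at an end of a diametral pair makes all spheres up to radius
    \<open>diam V E\<close> nonempty, as \<open>card_sphere_le\<close> demands: a geodesic to
    \<open>y\<close> meets each of them.\<close>
  obtain x y where x: "x \<in> V" and y: "y \<in> V" and xy: "dist' x y = diam V E"
    by (rule diam_attained)
  have nonempty: "gsphere x i \<noteq> {}" if "i \<le> diam V E" for i
  proof -
    obtain p where "p 0 = x" "p (dist' x y) = y" "\<forall>i<dist' x y. {p i, p (Suc i)} \<in> E"
      and p: "\<forall>i\<le>dist' x y. p i \<in> V \<and> dist' x (p i) = i"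
      by (rule geodesic[OF x y])
    have "p i \<in> gsphere x i" using p that xy by (simp add: gsphere_def)
    then show ?thesis by blast
  qed
  have "V = (\<Union>k\<in>{0..diam V E}. gsphere x k)"
    using dist_le_diam[OF x] by (auto simp: gsphere_def)
  then have "card V \<le> (\<Sum>k = 0..diam V E. card (gsphere x k))"
    using card_UN_le[of "{0..diam V E}" "gsphere x"] by simp
  also have "\<dots> = 1 + (\<Sum>k = 1..diam V E. card (gsphere x k))"
    by (simp add: sum.atLeast_Suc_atMost sphere_0[OF x])
  finally have "real (card V) \<le> 1 + (\<Sum>k = 1..diam V E. real (card (gsphere x k)))"
    by (simp flip: of_nat_sum)
  also have "\<dots> \<le> 1 + (\<Sum>k = 1..diam V E. real (max_deg V E) ^ k *
      (\<Prod>i = 1..k - 1. 1 + (curv_deficit V E \<kappa>\<^sub>0 - real i * \<kappa>\<^sub>0) / 2))"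
  proof (intro add_left_mono sum_mono)
    fix k assume "k \<in> {1..diam V E}"
    then obtain j where "k = Suc j" "j < diam V E" by (cases k) auto
    then show "real (card (gsphere x k)) \<le> real (max_deg V E) ^ k *
        (\<Prod>i = 1..k - 1. 1 + (curv_deficit V E \<kappa>\<^sub>0 - real i * \<kappa>\<^sub>0) / 2)"
      using card_sphere_le[OF x, of j \<kappa>\<^sub>0] nonempty by simp
  qed
  finally show ?thesis .
qed

text \<open>Apply \<open>outer_nbhd_bound\<close> to a diametral pair and use only that a proportion
  is nonnegative.\<close>

lemma diam_le:
  assumes "0 < \<kappa>\<^sub>0"
  shows "diam V E \<le> nat \<lfloor>(2 + curv_deficit V E \<kappa>\<^sub>0) / \<kappa>\<^sub>0\<rfloor>"
proof (cases "diam V E = 0")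
  case False
  obtain x y where x: "x \<in> V" and y: "y \<in> V" and xy: "dist' x y = diam V E"
    by (rule diam_attained)
  then have "x \<noteq> y" using False dist_self by auto
  from outer_nbhd_bound[OF x y this, of \<kappa>\<^sub>0]
  have "0 \<le> 1 + (curv_deficit V E \<kappa>\<^sub>0 - real (diam V E) * \<kappa>\<^sub>0) / 2"
    unfolding xy by (rule order_trans[rotated]) simp
  then have "real (diam V E) \<le> (2 + curv_deficit V E \<kappa>\<^sub>0) / \<kappa>\<^sub>0"
    using assms by (simp add: field_simps)
  then show ?thesis by (simp add: le_nat_floor)
qed simp

text \<open>Since \<open>diam V E\<close> is at most the new limit \<open>?N\<close>, it suffices
  that the terms added to the sum in \<open>card_le_diam\<close> are nonnegative.\<close>

theorem card_le_curvature:
  assumes "0 < \<kappa>\<^sub>0"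
  shows "real (card V) \<le> 1 + (\<Sum>k = 1..nat \<lfloor>(2 + curv_deficit V E \<kappa>\<^sub>0) / \<kappa>\<^sub>0\<rfloor>. real (max_deg V E) ^ k *
     (\<Prod>i = 1..k - 1. 1 + (curv_deficit V E \<kappa>\<^sub>0 - real i * \<kappa>\<^sub>0) / 2))"
proof -
  let ?N = "nat \<lfloor>(2 + curv_deficit V E \<kappa>\<^sub>0) / \<kappa>\<^sub>0\<rfloor>"
  have factor: "0 \<le> 1 + (curv_deficit V E \<kappa>\<^sub>0 - real i * \<kappa>\<^sub>0) / 2" if "0 < i" "i \<le> ?N" for i
  proof -
    \<comment> \<open>From \<open>0 < i\<close> the floor is positive, so \<open>nat\<close> has not
      truncated it. The inequality says exactly that factor \<open>i\<close> is nonnegative.\<close>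
    have "real i \<le> (2 + curv_deficit V E \<kappa>\<^sub>0) / \<kappa>\<^sub>0" using that by linarith
    then show ?thesis using assms by (simp add: field_simps)
  qed
  have "(\<Sum>k = 1..diam V E. real (max_deg V E) ^ k *
      (\<Prod>i = 1..k - 1. 1 + (curv_deficit V E \<kappa>\<^sub>0 - real i * \<kappa>\<^sub>0) / 2)) \<le>
    (\<Sum>k = 1..?N. real (max_deg V E) ^ k *
      (\<Prod>i = 1..k - 1. 1 + (curv_deficit V E \<kappa>\<^sub>0 - real i * \<kappa>\<^sub>0) / 2))"
    using diam_le[OF assms]
    by (intro sum_mono2 mult_nonneg_nonneg prod_nonneg factor) auto
  with card_le_diam[of \<kappa>\<^sub>0] show ?thesis by linarith
qed

end

theorem theorem1p2:
  fixes V :: "'a set" and E :: "'a set set" and \<kappa>\<^sub>0 :: real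
  assumes "finite_simple_graph V E" and "connected_graph V E"
  shows "real (card V) \<le> 1 + (\<Sum>k = 1..diam V E. real (max_deg V E) ^ k *
           (\<Prod>i = 1..k - 1. 1 + (curv_deficit V E \<kappa>\<^sub>0 - real i * \<kappa>\<^sub>0) / 2))
    \<and> (\<kappa>\<^sub>0 > 0 \<longrightarrow>
         real (card V) \<le> 1 + (\<Sum>k = 1..nat \<lfloor>(2 + curv_deficit V E \<kappa>\<^sub>0) / \<kappa>\<^sub>0\<rfloor>. real (max_deg V E) ^ k *
           (\<Prod>i = 1..k - 1. 1 + (curv_deficit V E \<kappa>\<^sub>0 - real i * \<kappa>\<^sub>0) / 2)))"
proof -
  interpret finite_connected_graph V E by unfold_locales fact+
  show ?thesis using card_le_diam card_le_curvature by blast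
qed

end
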